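(* Consider a tower of fibrations $$E_r\stackrel{p_r}{\to}E_{r-1}\stackrel{p_{r-1}}{\to}E_{r-2}\to\dots\stackrel{p_1}{\to}E_0$$ in which all spaces $E_i$ are normal, and let $p=p_1p_2\cdots p_r:E_r\to E_0$ be the total fibration. Then $$\mathsf{secat}[p_1:E_1\to E_0]\ \le\ \mathsf{secat}[p:E_r\to E_0]\ \le\ \mathsf{secat}[p_1:E_1\to E_0]+\sum_{i=1}^{r-1}\mathsf{secat}_{(p_1p_2\cdots p_i)}[p_{i+1}:E_{i+1}\to E_i],$$ where $p_1p_2\cdots p_i:E_i\to E_0$ denotes the composition.
   Context: For a (Hurewicz) fibration $q:E\to B$, $\mathsf{secat}[q:E\to B]$ is the smallest integer $k\ge0$ such that $B$ has an open cover $U_0,\dots,U_k$ with a continuous section of $q$ over each $U_i$ ($\infty$ if none exists). For a fibration $q:E\to B$ and a continuous map $f:B\to C$, $\mathsf{secat}_f[q:E\to B]$ is the smallest integer $k\ge 0$ such that there are open sets $U_0,\dots,U_k\subset C$ with $f(B)\subset U_0\cup\dots\cup U_k$ and such that $q$ admits a continuous section over each $f^{-1}(U_i)$ ($\infty$ if none exists). *)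

theory Defs
  imports "HOL-Analysis.Analysis" "HOL-Library.Extended_Nat"
begin

text \<open>Homotopy lifting property of \<open>q : E \<rightarrow> B\<close> for the test space \<open>X\<close>. As in
  \<^const>\<open>homotopic_with\<close>, the parameter of a homotopy is its first argument.\<close>

definition homotopy_lifting ::
    "'x topology \<Rightarrow> 'e topology \<Rightarrow> 'b topology \<Rightarrow> ('e \<Rightarrow> 'b) \<Rightarrow> bool" where
  "homotopy_lifting X E B q \<longleftrightarrow>
     (\<forall>h f. continuous_map (prod_topology (top_of_set {0..1::real}) X) B h \<and>
            continuous_map X E f \<and> (\<forall>x\<in>topspace X. q (f x) = h (0, x)) \<longrightarrow>
        (\<exists>k. continuous_map (prod_topology (top_of_set {0..1::real}) X) E k \<and>
             (\<forall>x\<in>topspace X. k (0, x) = f x) \<and>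
             (\<forall>t\<in>{0..1}. \<forall>x\<in>topspace X. q (k (t, x)) = h (t, x))))"

text \<open>A Hurewicz fibration has the homotopy lifting property for all spaces. A definition
  cannot quantify over types, so the test spaces range over all topologies on (subsets of) the
  type \<^typ>\<open>'e \<times> (real \<Rightarrow> 'b)\<close>, which is large enough to give the lifting property for
  spaces of every type: see \<open>hurewicz_fibration_homotopy_lifting\<close> below.\<close>

definition hurewicz_fibration :: "'e topology \<Rightarrow> 'b topology \<Rightarrow> ('e \<Rightarrow> 'b) \<Rightarrow> bool" where
  "hurewicz_fibration E B q \<longleftrightarrow>
     continuous_map E B q \<and>
     (\<forall>X :: ('e \<times> (real \<Rightarrow> 'b)) topology. homotopy_lifting X E B q)"

lemma quotient_topology_exists:
  obtains Y where "quotient_map X Y g"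
proof -
  let ?P = "\<lambda>V. V \<subseteq> g ` topspace X \<and> openin X {x \<in> topspace X. g x \<in> V}"
  have *: "istopology ?P"
    unfolding istopology_def
  proof (intro conjI allI impI)
    fix S T assume S: "?P S" and T: "?P T"
    show "S \<inter> T \<subseteq> g ` topspace X" using S by blast
    have "{x \<in> topspace X. g x \<in> S \<inter> T}
        = {x \<in> topspace X. g x \<in> S} \<inter> {x \<in> topspace X. g x \<in> T}" by blast
    then show "openin X {x \<in> topspace X. g x \<in> S \<inter> T}"
      using S T by (simp add: openin_Int)
  next
    fix K assume K: "\<forall>S\<in>K. ?P S"
    show "\<Union>K \<subseteq> g ` topspace X" using K by blast
    have "{x \<in> topspace X. g x \<in> \<Union>K} = (\<Union>S\<in>K. {x \<in> topspace X. g x \<in> S})" by blast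
    moreover have "openin X (\<Union>S\<in>K. {x \<in> topspace X. g x \<in> S})"
      using K by (intro openin_Union) auto
    ultimately show "openin X {x \<in> topspace X. g x \<in> \<Union>K}" by simp
  qed
  define Y where "Y = topology ?P"
  have op: "openin Y = ?P"
    unfolding Y_def using * by (rule topology_inverse')
  have "{x \<in> topspace X. g x \<in> g ` topspace X} = topspace X" by blast
  then have "?P (g ` topspace X)" by simp
  then have "topspace Y = g ` topspace X"
    unfolding topspace_def op by blast
  then have "quotient_map X Y g"
    unfolding quotient_map_def op by auto
  then show ?thesis by (rule that)
qed

lemma hurewicz_fibration_homotopy_lifting:
  fixes X :: "'x topology" and E :: "'e topology" and B :: "'b topology"
  assumes "hurewicz_fibration E B q"
  shows "homotopy_lifting X E B q"
  unfolding homotopy_lifting_def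
proof (intro allI impI, elim conjE)
  let ?I = "top_of_set {0..1::real}"
  fix h f
  assume h: "continuous_map (prod_topology ?I X) B h" and f: "continuous_map X E f"
    and hf: "\<forall>x\<in>topspace X. q (f x) = h (0, x)"
  define g where "g = (\<lambda>x. (f x, \<lambda>t. if t \<in> {0..1::real} then h (t, x) else undefined))"
  obtain Y where g: "quotient_map X Y g"
    by (rule quotient_topology_exists)
  have img: "g ` topspace X = topspace Y"
    using g by (simp add: quotient_map_def)
  define h' where "h' = (\<lambda>(t::real, y::'e \<times> (real \<Rightarrow> 'b)). snd y t)"
  have loc: "locally_compact_space ?I"
    by (simp add: compact_imp_locally_compact_space compact_space_subtopology)
  have Haus: "Hausdorff_space ?I"
    by (simp add: Hausdorff_space_subtopology)
  have qg: "quotient_map (prod_topology ?I X) (prod_topology ?I Y) (\<lambda>(t, x). (t, g x))"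
    using loc Haus g by (blast intro: quotient_map_prod_right)
  have f': "continuous_map Y E fst"
  proof (rule continuous_compose_quotient_map [OF g])
    show "continuous_map X E (fst \<circ> g)"
      using f by (simp add: g_def comp_def)
  qed
  have h': "continuous_map (prod_topology ?I Y) B h'"
  proof (rule continuous_compose_quotient_map [OF qg])
    show "continuous_map (prod_topology ?I X) B (h' \<circ> (\<lambda>(t, x). (t, g x)))"
      by (rule continuous_map_eq [OF h]) (auto simp: h'_def g_def)
  qed
  have "\<forall>y\<in>topspace Y. q (fst y) = h' (0, y)"
    using hf by (auto simp: img [symmetric] g_def h'_def)
  moreover have "homotopy_lifting Y E B q"
    using assms by (simp add: hurewicz_fibration_def)
  ultimately obtain k where k: "continuous_map (prod_topology ?I Y) E k"
    and k0: "\<forall>y\<in>topspace Y. k (0, y) = fst y"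
    and qk: "\<forall>t\<in>{0..1}. \<forall>y\<in>topspace Y. q (k (t, y)) = h' (t, y)"
    unfolding homotopy_lifting_def using f' h' by blast
  have "continuous_map (prod_topology ?I X) E (k \<circ> (\<lambda>(t, x). (t, g x)))"
    using quotient_imp_continuous_map [OF qg] k by (rule continuous_map_compose)
  moreover have gY: "g x \<in> topspace Y" if "x \<in> topspace X" for x
    using that img by blast
  moreover have "\<forall>x\<in>topspace X. (k \<circ> (\<lambda>(t, x). (t, g x))) (0, x) = f x"
    using k0 gY by (simp add: g_def)
  moreover have "\<forall>t\<in>{0..1}. \<forall>x\<in>topspace X. q ((k \<circ> (\<lambda>(t, x). (t, g x))) (t, x)) = h (t, x)"
    using qk gY by (simp add: h'_def) (simp add: g_def)
  ultimately show "\<exists>k. continuous_map (prod_topology ?I X) E k \<and>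
             (\<forall>x\<in>topspace X. k (0, x) = f x) \<and>
             (\<forall>t\<in>{0..1}. \<forall>x\<in>topspace X. q (k (t, x)) = h (t, x))"
    by blast
qed

definition section_over ::
    "'e topology \<Rightarrow> 'b topology \<Rightarrow> ('e \<Rightarrow> 'b) \<Rightarrow> 'b set \<Rightarrow> ('b \<Rightarrow> 'e) \<Rightarrow> bool" where
  "section_over E B q U s \<longleftrightarrow>
     continuous_map (subtopology B U) E s \<and> (\<forall>x\<in>topspace B \<inter> U. q (s x) = x)"

text \<open>In \<^typ>\<open>enat\<close> the infimum of a nonempty set is its least element, and \<open>Inf {} = \<infinity>\<close>.\<close>

definition secat :: "'e topology \<Rightarrow> 'b topology \<Rightarrow> ('e \<Rightarrow> 'b) \<Rightarrow> enat" where
  "secat E B q = Inf {enat k | k. \<exists>U :: nat \<Rightarrow> 'b set.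
     (\<forall>i\<le>k. openin B (U i)) \<and> topspace B = (\<Union>i\<le>k. U i) \<and>
     (\<forall>i\<le>k. \<exists>s. section_over E B q (U i) s)}"

definition secat_rel ::
    "'e topology \<Rightarrow> 'b topology \<Rightarrow> 'c topology \<Rightarrow> ('b \<Rightarrow> 'c) \<Rightarrow> ('e \<Rightarrow> 'b) \<Rightarrow> enat" where
  "secat_rel E B C f q = Inf {enat k | k. \<exists>U :: nat \<Rightarrow> 'c set.
     (\<forall>i\<le>k. openin C (U i)) \<and> f ` topspace B \<subseteq> (\<Union>i\<le>k. U i) \<and>
     (\<forall>i\<le>k. \<exists>s. section_over E B q {x \<in> topspace B. f x \<in> U i} s)}"

text \<open>\<open>tower_comp p i = p 1 \<circ> p 2 \<circ> \<dots> \<circ> p i : E i \<rightarrow> E 0\<close>. All spaces of a tower live on subsets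
  of one type; finitely many spaces of different types can be moved to their sum type.\<close>

primrec tower_comp :: "(nat \<Rightarrow> 'a \<Rightarrow> 'a) \<Rightarrow> nat \<Rightarrow> 'a \<Rightarrow> 'a" where
  "tower_comp p 0 = id"
| "tower_comp p (Suc i) = tower_comp p i \<circ> p (Suc i)"

end

theory Submission
  imports Defs
begin

text \<open>For the lower bound, a section of \<open>p\<close> followed by \<open>p\<^sub>2 \<dots> p\<^sub>r\<close> is a section of \<open>p\<^sub>1\<close>.
  The upper bound follows by induction from \<open>secat (q \<circ> p) \<le> secat q + secat\<^sub>q p\<close>.
  Over \<open>U\<^sub>a \<inter> V\<^sub>b\<close> a section of \<open>q \<circ> p\<close> is obtained by composing sections of \<open>q\<close> over
  \<open>U\<^sub>a\<close> and of \<open>p\<close> over \<open>q\<^sup>-\<^sup>1 V\<^sub>b\<close>. If \<open>secat q\<close> is finite then \<open>q\<close> is surjective, so the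
  \<open>V\<^sub>b\<close> cover the whole base and not just the image of \<open>q\<close>. Normality allows one to shrink the
  sets \<open>U\<^sub>a \<inter> V\<^sub>b\<close> to an open cover \<open>W\<^sub>a\<^sub>b\<close> whose members with a common value of \<open>a + b\<close> are
  disjoint; sections over these glue, leaving one open set for each value of \<open>a + b\<close>.\<close>

section \<open>Open covers of normal spaces\<close>

text \<open>Induction on the index set: Urysohn's lemma gives \<open>g\<close>, zero off
  \<open>U i\<close> and one on the part of \<open>S\<close> that the remaining sets miss. The
  closed set \<open>S\<close> varies in the induction because the other functions only have to
  handle the points of \<open>S\<close> where \<open>g\<close> vanishes.\<close>

lemma normal_space_finite_cover_functions:
  fixes U :: "'i \<Rightarrow> 'a set"
  assumes "normal_space X" "finite I" "closedin X S"
    and "\<And>i. i \<in> I \<Longrightarrow> openin X (U i)" and "S \<subseteq> (\<Union>i\<in>I. U i)"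
  shows "\<exists>f. (\<forall>i\<in>I. continuous_map X euclideanreal (f i) \<and>
                    (\<forall>x\<in>topspace X. 0 \<le> f i x \<and> (0 < f i x \<longrightarrow> x \<in> U i))) \<and>
             (\<forall>x\<in>S. \<exists>i\<in>I. 0 < f i x)"
  using assms(2-)
proof (induction I arbitrary: S rule: finite_induct)
  case empty
  then show ?case by simp
next
  case (insert i I)
  define T where "T = S - (\<Union>j\<in>I. U j)"
  have T: "closedin X T"
    unfolding T_def using insert.prems by (intro closedin_diff openin_Union) auto
  moreover have "closedin X (topspace X - U i)"
    using insert.prems by blast
  moreover have "disjnt (topspace X - U i) T"
    using insert.prems by (auto simp: disjnt_def T_def)
  ultimately obtain g where "continuous_map X (top_of_set {0..1::real}) g"
    and g0: "g ` (topspace X - U i) \<subseteq> {0}" and g1: "g ` T \<subseteq> {1}"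
    using Urysohn_lemma [OF assms(1), of "topspace X - U i" T 0 1] by (metis zero_le_one)
  then have g: "continuous_map X euclideanreal g"
    and gge: "\<And>x. x \<in> topspace X \<Longrightarrow> 0 \<le> g x"
    by (auto simp: continuous_map_in_subtopology Pi_iff image_subset_iff)
  \<comment> \<open>No point of \<open>S'\<close> lies in \<open>T\<close>, where \<open>g\<close>
    is one, so the remaining \<open>U j\<close> cover \<open>S'\<close>.\<close>
  define S' where "S' = S \<inter> {x \<in> topspace X. g x \<in> {0}}"
  have "closedin X S'"
    unfolding S'_def using insert.prems
    by (intro closedin_Int closedin_continuous_map_preimage [OF g]) auto
  moreover have "S' \<subseteq> (\<Union>j\<in>I. U j)"
    using g1 by (force simp: S'_def T_def)
  ultimately obtain f where
    f: "\<forall>j\<in>I. continuous_map X euclideanreal (f j) \<and>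
          (\<forall>x\<in>topspace X. 0 \<le> f j x \<and> (0 < f j x \<longrightarrow> x \<in> U j))"
    and fS: "\<forall>x\<in>S'. \<exists>j\<in>I. 0 < f j x"
    using insert.IH [of S'] insert.prems by auto
  have "\<forall>j\<in>insert i I. continuous_map X euclideanreal ((f(i := g)) j) \<and>
          (\<forall>x\<in>topspace X. 0 \<le> (f(i := g)) j x \<and> (0 < (f(i := g)) j x \<longrightarrow> x \<in> U j))"
  proof
    fix j assume "j \<in> insert i I"
    moreover have "x \<in> U i" if "x \<in> topspace X" "0 < g x" for x
      using that g0 by (cases "x \<in> U i") auto
    ultimately show "continuous_map X euclideanreal ((f(i := g)) j) \<and>
          (\<forall>x\<in>topspace X. 0 \<le> (f(i := g)) j x \<and> (0 < (f(i := g)) j x \<longrightarrow> x \<in> U j))"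
      using f g gge by (cases "j = i") simp_all
  qed
  moreover have "\<forall>x\<in>S. \<exists>j\<in>insert i I. 0 < (f(i := g)) j x"
  proof
    fix x assume x: "x \<in> S"
    then have xX: "x \<in> topspace X"
      using insert.prems closedin_subset by blast
    show "\<exists>j\<in>insert i I. 0 < (f(i := g)) j x"
    proof (cases "g x = 0")
      case True
      then have "x \<in> S'" using x xX by (simp add: S'_def)
      then obtain j where "j \<in> I" "0 < f j x" using fS by blast
      then show ?thesis using insert.hyps by (intro bexI [of _ j]) auto
    next
      case False
      then show ?thesis using gge [OF xX] by (intro bexI [of _ i]) auto
    qed
  qed
  ultimately show ?case by blast
qed

text \<open>At a point where \<open>a\<close> and \<open>b\<close> are the least indices maximising \<open>f a\<close> and \<open>g b\<close>, the
  product \<open>f a * g b\<close> is strictly larger than every other product with the same index sum.\<close>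

lemma normal_space_combine_covers:
  fixes U V :: "nat \<Rightarrow> 'a set"
  assumes X: "normal_space X"
    and U: "\<forall>a\<le>k. openin X (U a)" "topspace X \<subseteq> (\<Union>a\<le>k. U a)"
    and V: "\<forall>b\<le>l. openin X (V b)" "topspace X \<subseteq> (\<Union>b\<le>l. V b)"
  shows "\<exists>W :: nat \<Rightarrow> nat \<Rightarrow> 'a set.
    (\<forall>a\<le>k. \<forall>b\<le>l. openin X (W a b) \<and> W a b \<subseteq> U a \<inter> V b) \<and>
    (\<forall>a\<le>k. \<forall>b\<le>l. \<forall>a'\<le>k. \<forall>b'\<le>l. a + b = a' + b' \<and> a \<noteq> a' \<longrightarrow> W a b \<inter> W a' b' = {}) \<and>
    topspace X = (\<Union>a\<le>k. \<Union>b\<le>l. W a b)"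
proof -
  obtain f where
    f: "\<And>a. a \<le> k \<Longrightarrow> continuous_map X euclideanreal (f a)"
       "\<And>a x. a \<le> k \<Longrightarrow> x \<in> topspace X \<Longrightarrow> 0 \<le> f a x"
       "\<And>a x. a \<le> k \<Longrightarrow> x \<in> topspace X \<Longrightarrow> 0 < f a x \<Longrightarrow> x \<in> U a"
       "\<And>x. x \<in> topspace X \<Longrightarrow> \<exists>a\<le>k. 0 < f a x"
    using normal_space_finite_cover_functions [OF X finite_atMost closedin_topspace, of k U] U
    unfolding Ball_def Bex_def atMost_iff by metis
  obtain g where
    g: "\<And>b. b \<le> l \<Longrightarrow> continuous_map X euclideanreal (g b)"
       "\<And>b x. b \<le> l \<Longrightarrow> x \<in> topspace X \<Longrightarrow> 0 \<le> g b x"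
       "\<And>b x. b \<le> l \<Longrightarrow> x \<in> topspace X \<Longrightarrow> 0 < g b x \<Longrightarrow> x \<in> V b"
       "\<And>x. x \<in> topspace X \<Longrightarrow> \<exists>b\<le>l. 0 < g b x"
    using normal_space_finite_cover_functions [OF X finite_atMost closedin_topspace, of l V] V
    unfolding Ball_def Bex_def atMost_iff by metis
  \<comment> \<open>\<open>F a b\<close> lists the rivals of \<open>(a, b)\<close> on its
    antidiagonal, and \<open>W a b\<close> is the region where the product for \<open>(a, b)\<close>
    is positive and beats them all. Two pairs on one antidiagonal cannot both win at the same
    point.\<close>
  define F where "F a b = {(a', b'). a' \<le> k \<and> b' \<le> l \<and> a' + b' = a + b \<and> a' \<noteq> a}" for a b
  define D where "D a b c x = f a x * g b x - f (fst c) x * g (snd c) x" for a b c x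
  \<comment> \<open>The last \<open>topspace X\<close> keeps the second factor open when
    \<open>F a b\<close> is empty and the intersection over it is \<open>UNIV\<close>.\<close>
  define W where "W a b = {x \<in> topspace X. f a x * g b x \<in> {0<..}} \<inter>
      ((\<Inter>c\<in>F a b. {x \<in> topspace X. D a b c x \<in> {0<..}}) \<inter> topspace X)" for a b
  have finF: "finite (F a b)" for a b
    by (rule finite_subset [of _ "{..k} \<times> {..l}"]) (auto simp: F_def)
  have W_iff: "x \<in> W a b \<longleftrightarrow> x \<in> topspace X \<and> 0 < f a x * g b x \<and>
      (\<forall>a'\<le>k. \<forall>b'\<le>l. a' + b' = a + b \<and> a' \<noteq> a \<longrightarrow> f a' x * g b' x < f a x * g b x)" for a b x
    by (auto simp: W_def F_def D_def)
  show ?thesis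
  proof (intro exI [of _ W] conjI allI impI; (elim conjE)?)
    fix a b assume ab: "a \<le> k" "b \<le> l"
    have "continuous_map X euclideanreal (D a b c)" if "c \<in> F a b" for c
      unfolding D_def using that ab
      by (intro continuous_map_diff continuous_map_real_mult f g) (auto simp: F_def)
    then show "openin X (W a b)"
      unfolding W_def using ab finF
      by (intro openin_Int openin_INT
            openin_continuous_map_preimage [where Y = euclideanreal]
            continuous_map_real_mult f g) auto
    show "W a b \<subseteq> U a \<inter> V b"
    proof
      fix x assume "x \<in> W a b"
      then have x: "x \<in> topspace X" "0 < f a x * g b x" by (auto simp: W_iff)
      then have "0 < f a x" "0 < g b x"
        using f(2) [OF ab(1) x(1)] g(2) [OF ab(2) x(1)] by (auto simp: zero_less_mult_iff)
      then show "x \<in> U a \<inter> V b" using f(3) g(3) ab x by blast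
    qed
  next
    fix a b a' b' assume *: "a \<le> k" "b \<le> l" "a' \<le> k" "b' \<le> l" "a + b = a' + b'" "a \<noteq> a'"
    have "False" if "x \<in> W a b" "x \<in> W a' b'" for x
    proof -
      have "f a' x * g b' x < f a x * g b x" "f a x * g b x < f a' x * g b' x"
        using that * unfolding W_iff by auto
      then show False by simp
    qed
    then show "W a b \<inter> W a' b' = {}" by blast
  next
    \<comment> \<open>Choosing the least maximiser breaks ties: every smaller index has a strictly
      smaller value.\<close>
    have least_max: "\<exists>a\<le>n. 0 < h a \<and> (\<forall>a'\<le>n. h a' \<le> h a) \<and> (\<forall>a'<a. h a' < h a)"
      if "\<exists>a\<le>n. 0 < h a" for h :: "nat \<Rightarrow> real" and n
    proof -
      define P where "P a \<longleftrightarrow> a \<le> n \<and> (\<forall>a'\<le>n. h a' \<le> h a)" for a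
      have "Max (h ` {..n}) \<in> h ` {..n}" by (intro Max_in) auto
      then obtain m where "m \<le> n" "h m = Max (h ` {..n})" by (metis atMost_iff imageE)
      then have "P m" by (simp add: P_def)
      then have P: "P (Least P)" by (rule LeastI)
      have "h a' < h (Least P)" if "a' < Least P" for a'
      proof -
        have "\<not> P a'" using that by (rule not_less_Least)
        moreover have "a' \<le> n" using that P by (simp add: P_def)
        ultimately show ?thesis using P unfolding P_def by force
      qed
      then show ?thesis using P that unfolding P_def by (meson less_le_trans)
    qed
    show "topspace X = (\<Union>a\<le>k. \<Union>b\<le>l. W a b)"
    proof
      show "(\<Union>a\<le>k. \<Union>b\<le>l. W a b) \<subseteq> topspace X" by (auto simp: W_iff)
      show "topspace X \<subseteq> (\<Union>a\<le>k. \<Union>b\<le>l. W a b)"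
      proof
        fix x assume x: "x \<in> topspace X"
        obtain a where a: "a \<le> k" "0 < f a x" "\<And>a'. a' \<le> k \<Longrightarrow> f a' x \<le> f a x"
          "\<And>a'. a' < a \<Longrightarrow> f a' x < f a x"
          using least_max [of k "\<lambda>a. f a x"] f(4) [OF x] by blast
        obtain b where b: "b \<le> l" "0 < g b x" "\<And>b'. b' \<le> l \<Longrightarrow> g b' x \<le> g b x"
          "\<And>b'. b' < b \<Longrightarrow> g b' x < g b x"
          using least_max [of l "\<lambda>b. g b x"] g(4) [OF x] by blast
        \<comment> \<open>If \<open>a' < a\<close>, strictness comes from minimality of
          \<open>a\<close>. Otherwise \<open>a' > a\<close>, the equal sums force
          \<open>b' < b\<close>, and strictness comes from minimality of \<open>b\<close>.\<close>
        have "f a' x * g b' x < f a x * g b x"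
          if "a' \<le> k" "b' \<le> l" "a' + b' = a + b" "a' \<noteq> a" for a' b'
        proof (cases "a' < a")
          case True
          have "f a' x * g b' x \<le> f a' x * g b x"
            using that b f(2) x by (intro mult_left_mono) auto
          also have "\<dots> < f a x * g b x"
            using True a b by (intro mult_strict_right_mono) auto
          finally show ?thesis .
        next
          case False
          then have "b' < b" using that by simp
          have "f a' x * g b' x \<le> f a x * g b' x"
            using that a g(2) x by (intro mult_right_mono) auto
          also have "\<dots> < f a x * g b x"
            using \<open>b' < b\<close> a b by (intro mult_strict_left_mono) auto
          finally show ?thesis .
        qed
        then have "x \<in> W a b" using x a(2) b(2) by (simp add: W_iff)
        then show "x \<in> (\<Union>a\<le>k. \<Union>b\<le>l. W a b)" using a(1) b(1) by blast
      qed
    qed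
  qed
qed

section \<open>Restricting, composing and gluing local sections\<close>

lemma section_over_subset:
  assumes "section_over E B q U s" "V \<subseteq> U"
  shows "section_over E B q V s"
  using assms continuous_map_from_subtopology_mono unfolding section_over_def by blast

lemma section_over_maps_to:
  assumes "section_over E B q U s" "x \<in> topspace B" "x \<in> U"
  shows "s x \<in> topspace E" "q (s x) = x"
  using assms continuous_map_funspace [of "subtopology B U" E s]
  unfolding section_over_def by auto

lemma section_over_comp:
  assumes s: "section_over B C q U s"
    and t: "section_over E B p {x \<in> topspace B. q x \<in> V} t"
  shows "section_over E C (q \<circ> p) (U \<inter> V) (t \<circ> s)"
proof -
  have "continuous_map (subtopology C (U \<inter> V)) B s"
    using section_over_subset [OF s, of "U \<inter> V"] by (simp add: section_over_def)
  \<comment> \<open>Since \<open>q (s x) = x\<close>, the section \<open>s\<close> carries points of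
    \<open>V\<close> into the preimage of \<open>V\<close>, where \<open>t\<close> is
    defined.\<close>
  then have "continuous_map (subtopology C (U \<inter> V)) (subtopology B {x \<in> topspace B. q x \<in> V}) s"
    using section_over_maps_to [OF s] by (auto simp: continuous_map_in_subtopology)
  moreover have "continuous_map (subtopology B {x \<in> topspace B. q x \<in> V}) E t"
    using t by (simp add: section_over_def)
  ultimately have "continuous_map (subtopology C (U \<inter> V)) E (t \<circ> s)"
    by (rule continuous_map_compose)
  then show ?thesis
    using section_over_maps_to [OF s] section_over_maps_to [OF t] by (simp add: section_over_def)
qed

text \<open>Distinct members never overlap, so the compatibility condition of the pasting lemma for
  open sets is automatic.\<close>

lemma section_over_disjoint_Union:
  assumes op: "\<And>i. i \<in> I \<Longrightarrow> openin B (W i)"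
    and disj: "\<And>i j. i \<in> I \<Longrightarrow> j \<in> I \<Longrightarrow> i \<noteq> j \<Longrightarrow> W i \<inter> W j = {}"
    and sec: "\<And>i. i \<in> I \<Longrightarrow> \<exists>s. section_over E B q (W i) s"
  shows "\<exists>s. section_over E B q (\<Union>i\<in>I. W i) s"
proof -
  let ?U = "\<Union>i\<in>I. W i"
  obtain s where s: "\<And>i. i \<in> I \<Longrightarrow> section_over E B q (W i) (s i)"
    using sec by metis
  have "\<exists>g. continuous_map (subtopology B ?U) E g \<and>
          (\<forall>x i. i \<in> I \<and> x \<in> topspace (subtopology B ?U) \<inter> W i \<longrightarrow> g x = s i x)"
  proof (rule pasting_lemma_exists)
    show "topspace (subtopology B ?U) \<subseteq> ?U" by simp
    show "openin (subtopology B ?U) (W i)" if "i \<in> I" for i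
      using openin_subtopology_Int [OF op [OF that], of ?U] that
      by (simp add: Int_absorb2 UN_upper)
    show "continuous_map (subtopology (subtopology B ?U) (W i)) E (s i)" if "i \<in> I" for i
      using s [OF that] that
      by (simp add: section_over_def subtopology_subtopology Int_absorb1 UN_upper)
    show "s i x = s j x" if "i \<in> I" "j \<in> I" "x \<in> topspace (subtopology B ?U) \<inter> W i \<inter> W j" for i j x
      using disj that by blast
  qed blast
  then obtain g where g: "continuous_map (subtopology B ?U) E g"
    "\<And>x i. i \<in> I \<Longrightarrow> x \<in> topspace B \<Longrightarrow> x \<in> W i \<Longrightarrow> g x = s i x"
    by auto
  have "section_over E B q ?U g"
    unfolding section_over_def using g section_over_maps_to(2) [OF s] by auto
  then show ?thesis by blast
qed

section \<open>Covers realising the sectional category, and its behaviour under composition\<close>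

text \<open>A finite infimum excludes the empty set, whose infimum is \<infinity>, and well-ordering
  then puts the infimum in the set. This turns a finite \<open>secat\<close> or
  \<open>secat_rel\<close> into an actual cover.\<close>

lemma Inf_enat_collect_attained:
  assumes "Inf {enat k | k. P k} = enat n"
  shows "P n"
proof -
  let ?A = "{enat k | k. P k}"
  have "?A \<noteq> {}"
  proof
    assume "?A = {}"
    then show False using assms by (simp only: Inf_enat_def) simp
  qed
  then obtain x where "x \<in> ?A" by blast
  then have "(LEAST x. x \<in> ?A) \<in> ?A" by (rule LeastI)
  then have "Inf ?A \<in> ?A" using \<open>?A \<noteq> {}\<close> by (simp only: Inf_enat_def if_False)
  then show ?thesis using assms by auto
qed

lemma secat_cover:
  assumes "secat E B q = enat k"
  shows "\<exists>U. (\<forall>i\<le>k. openin B (U i)) \<and> topspace B = (\<Union>i\<le>k. U i) \<and>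
     (\<forall>i\<le>k. \<exists>s. section_over E B q (U i) s)"
  using assms unfolding secat_def by (rule Inf_enat_collect_attained)

lemma secat_rel_cover:
  assumes "secat_rel E B C f q = enat k"
  shows "\<exists>U. (\<forall>i\<le>k. openin C (U i)) \<and> f ` topspace B \<subseteq> (\<Union>i\<le>k. U i) \<and>
     (\<forall>i\<le>k. \<exists>s. section_over E B q {x \<in> topspace B. f x \<in> U i} s)"
  using assms unfolding secat_rel_def by (rule Inf_enat_collect_attained)

lemma secat_le:
  assumes "\<And>i. i \<le> k \<Longrightarrow> openin B (U i)" "topspace B = (\<Union>i\<le>k. U i)"
    and "\<And>i. i \<le> k \<Longrightarrow> \<exists>s. section_over E B q (U i) s"
  shows "secat E B q \<le> enat k"
  unfolding secat_def using assms by (intro Inf_lower) blast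

text \<open>The same open cover serves both maps: \<open>h \<circ> s\<close> is a section of
  \<open>q\<close> wherever \<open>s\<close> is a section of \<open>q'\<close>.\<close>

lemma secat_left_factor_le:
  assumes h: "continuous_map E' E h" and q: "\<And>x. x \<in> topspace E' \<Longrightarrow> q' x = q (h x)"
  shows "secat E B q \<le> secat E' B q'"
proof (cases "secat E' B q'")
  case (enat k)
  from secat_cover [OF this] obtain U where U: "\<And>i. i \<le> k \<Longrightarrow> openin B (U i)" "topspace B = (\<Union>i\<le>k. U i)"
    and sec: "\<And>i. i \<le> k \<Longrightarrow> \<exists>s. section_over E' B q' (U i) s"
    by blast
  have "\<exists>s. section_over E B q (U i) s" if i: "i \<le> k" for i
  proof -
    obtain s where s: "section_over E' B q' (U i) s" using sec [OF i] by blast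
    then have "continuous_map (subtopology B (U i)) E (h \<circ> s)"
      using h by (auto simp: section_over_def intro: continuous_map_compose)
    then have "section_over E B q (U i) (h \<circ> s)"
      using section_over_maps_to [OF s] q by (simp add: section_over_def)
    then show ?thesis by blast
  qed
  then show ?thesis using U enat by (metis secat_le)
qed simp

lemma secat_comp_le:
  assumes C: "normal_space C"
  shows "secat E C (q \<circ> p) \<le> secat B C q + secat_rel E B C q p"
\<comment> \<open>Only the case of two finite values has content; otherwise the right-hand side is
  \<infinity>.\<close>
proof (cases "secat B C q"; cases "secat_rel E B C q p")
  fix k l
  assume k: "secat B C q = enat k" and l: "secat_rel E B C q p = enat l"
  from secat_cover [OF k] obtain U
    where U: "\<forall>a\<le>k. openin C (U a)" "topspace C = (\<Union>a\<le>k. U a)"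
    and secU: "\<And>a. a \<le> k \<Longrightarrow> \<exists>s. section_over B C q (U a) s"
    by blast
  from secat_rel_cover [OF l] obtain V
    where V: "\<forall>b\<le>l. openin C (V b)" "q ` topspace B \<subseteq> (\<Union>b\<le>l. V b)"
    and secV: "\<And>b. b \<le> l \<Longrightarrow> \<exists>t. section_over E B p {x \<in> topspace B. q x \<in> V b} t"
    by blast
  have "topspace C \<subseteq> q ` topspace B"
  proof
    fix x assume x: "x \<in> topspace C"
    then obtain a where a: "a \<le> k" "x \<in> U a" using U(2) by blast
    then obtain s where "section_over B C q (U a) s" using secU by blast
    from section_over_maps_to [OF this x a(2)] show "x \<in> q ` topspace B"
      by (metis image_eqI)
  qed
  then have V': "topspace C \<subseteq> (\<Union>b\<le>l. V b)" using V(2) by blast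
  obtain W where W: "\<forall>a\<le>k. \<forall>b\<le>l. openin C (W a b) \<and> W a b \<subseteq> U a \<inter> V b"
    and disj: "\<forall>a\<le>k. \<forall>b\<le>l. \<forall>a'\<le>k. \<forall>b'\<le>l.
      a + b = a' + b' \<and> a \<noteq> a' \<longrightarrow> W a b \<inter> W a' b' = {}"
    and cov: "topspace C = (\<Union>a\<le>k. \<Union>b\<le>l. W a b)"
    using normal_space_combine_covers [OF C U(1) equalityD1 [OF U(2)] V(1) V']
    by - (elim exE conjE, rule that)
  have opW: "openin C (W a b)" and WUV: "W a b \<subseteq> U a \<inter> V b" if "a \<le> k" "b \<le> l" for a b
    using W that by simp_all
  \<comment> \<open>The sums of indices from 0 to \<open>k\<close> and from 0 to \<open>l\<close>
    run from 0 to \<open>k + l\<close>, giving the \<open>k + l + 1\<close> open sets that the bound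
    \<open>enat (k + l)\<close> allows.\<close>
  define I where "I j = {(a, b). a \<le> k \<and> b \<le> l \<and> a + b = j}" for j
  have "secat E C (q \<circ> p) \<le> enat (k + l)"
  proof (rule secat_le [where U = "\<lambda>j. \<Union>c\<in>I j. W (fst c) (snd c)"])
    show "openin C (\<Union>c\<in>I j. W (fst c) (snd c))" for j
      using opW by (intro openin_Union) (auto simp: I_def)
    show "topspace C = (\<Union>j\<le>k + l. \<Union>c\<in>I j. W (fst c) (snd c))"
      unfolding cov by (fastforce simp: I_def)
    show "\<exists>s. section_over E C (q \<circ> p) (\<Union>c\<in>I j. W (fst c) (snd c)) s" for j
    proof (rule section_over_disjoint_Union)
      fix c assume "c \<in> I j"
      then have c: "fst c \<le> k" "snd c \<le> l" by (auto simp: I_def)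
      then show "openin C (W (fst c) (snd c))" by (rule opW)
      obtain s where s: "section_over B C q (U (fst c)) s" using secU [OF c(1)] by blast
      obtain t where t: "section_over E B p {x \<in> topspace B. q x \<in> V (snd c)} t"
        using secV [OF c(2)] by blast
      show "\<exists>s. section_over E C (q \<circ> p) (W (fst c) (snd c)) s"
        using section_over_subset [OF section_over_comp [OF s t] WUV [OF c]] by blast
    next
      \<comment> \<open>Distinct pairs with the same sum differ in the first coordinate, as
        \<open>disj\<close> requires.\<close>
      fix c d assume "c \<in> I j" "d \<in> I j" "c \<noteq> d"
      then show "W (fst c) (snd c) \<inter> W (fst d) (snd d) = {}"
        by (intro disj [rule_format]) (auto simp: I_def)
    qed
  qed
  then show ?thesis using k l by simp
qed auto

section \<open>Towers\<close>

text \<open>\<open>tower_comp\<close> appends maps on the right, so \<open>p 1\<close> stays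
  outermost and \<open>h\<close> is the composite of the later maps, the identity for
  \<open>n = 0\<close>. The index \<open>n + 1\<close> ensures that \<open>p 1\<close>
  occurs.\<close>

lemma tower_comp_factor:
  assumes "\<And>i. 1 \<le> i \<Longrightarrow> i < n + 2 \<Longrightarrow> continuous_map (E i) (E (i - 1)) (p i)"
  shows "\<exists>h. continuous_map (E (n + 1)) (E 1) h \<and> tower_comp p (n + 1) = p 1 \<circ> h"
  using assms
proof (induction n)
  case 0
  show ?case by (rule exI [of _ id]) simp
next
  case (Suc n)
  have "\<exists>h. continuous_map (E (n + 1)) (E 1) h \<and> tower_comp p (n + 1) = p 1 \<circ> h"
    by (rule Suc.IH, rule Suc.prems) auto
  then obtain h where "continuous_map (E (n + 1)) (E 1) h" "tower_comp p (n + 1) = p 1 \<circ> h"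
    by blast
  moreover have "continuous_map (E (Suc n + 1)) (E (n + 1)) (p (Suc n + 1))"
    using Suc.prems [of "Suc n + 1"] by simp
  moreover have "tower_comp p (Suc n + 1) = tower_comp p (n + 1) \<circ> p (Suc n + 1)"
    by simp
  ultimately show ?case
    by (metis comp_assoc continuous_map_compose)
qed

text \<open>Each induction step splits off the topmost map: \<open>secat_comp_le\<close> with
  \<open>q\<close> the composite of the lower maps contributes exactly the last summand.\<close>

lemma secat_tower_comp_le:
  assumes "normal_space (E 0)"
  shows "secat (E (n + 1)) (E 0) (tower_comp p (n + 1)) \<le> secat (E 1) (E 0) (p 1) +
      (\<Sum>i\<in>{1..<n + 1}. secat_rel (E (i + 1)) (E i) (E 0) (tower_comp p i) (p (i + 1)))"
proof (induction n)
  case 0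
  then show ?case by simp
next
  case (Suc n)
  have "secat (E (Suc n + 1)) (E 0) (tower_comp p (Suc n + 1))
      \<le> secat (E (n + 1)) (E 0) (tower_comp p (n + 1)) +
        secat_rel (E (Suc n + 1)) (E (n + 1)) (E 0) (tower_comp p (n + 1)) (p (Suc n + 1))"
    using secat_comp_le [OF assms, of "E (Suc n + 1)" "tower_comp p (n + 1)" "p (Suc n + 1)"]
    by simp
  also have "\<dots> \<le> (secat (E 1) (E 0) (p 1) +
      (\<Sum>i\<in>{1..<n + 1}. secat_rel (E (i + 1)) (E i) (E 0) (tower_comp p i) (p (i + 1)))) +
        secat_rel (E (Suc n + 1)) (E (n + 1)) (E 0) (tower_comp p (n + 1)) (p (Suc n + 1))"
    by (rule add_right_mono [OF Suc.IH])
  finally show ?case by (simp add: add.assoc del: tower_comp.simps)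
qed

theorem theorem5p1:
  fixes E :: "nat \<Rightarrow> 'a topology" and p :: "nat \<Rightarrow> 'a \<Rightarrow> 'a" and r :: nat
  assumes "r \<ge> 1"
    and "\<And>i. i \<le> r \<Longrightarrow> normal_space (E i)"
    and "\<And>i. 1 \<le> i \<Longrightarrow> i \<le> r \<Longrightarrow> hurewicz_fibration (E i) (E (i - 1)) (p i)"
  shows "secat (E 1) (E 0) (p 1) \<le> secat (E r) (E 0) (tower_comp p r) \<and>
    secat (E r) (E 0) (tower_comp p r) \<le>
      secat (E 1) (E 0) (p 1) +
      (\<Sum>i\<in>{1..<r}. secat_rel (E (i + 1)) (E i) (E 0) (tower_comp p i) (p (i + 1)))"
proof -
  obtain n where r: "r = n + 1" using assms(1) by (metis le_add_diff_inverse2)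
  have "\<exists>h. continuous_map (E (n + 1)) (E 1) h \<and> tower_comp p (n + 1) = p 1 \<circ> h"
    using assms(3) r by (intro tower_comp_factor) (auto simp: hurewicz_fibration_def)
  then obtain h where "continuous_map (E r) (E 1) h" "tower_comp p r = p 1 \<circ> h"
    using r by blast
  then have "secat (E 1) (E 0) (p 1) \<le> secat (E r) (E 0) (tower_comp p r)"
    by (intro secat_left_factor_le) auto
  moreover have "normal_space (E 0)" using assms(2) by blast
  ultimately show ?thesis using secat_tower_comp_le r by blast
qed

end
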